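(* Let $f:\mathbb{R}^m\to\mathbb{R}$ be a $C^1$ function which has at most countably many critical points. Let $z_0\in\mathbb{R}^m$, $0<\alpha,\beta<1$ and $\delta_0>0$. 1) Assume that $\nabla f$ is locally Lipschitz near every critical point of $f$. Let $\{z_n\}_{n\ge0}$ be the sequence constructed from the Backtracking gradient descent update rule $z_n=z_{n-1}-\delta(f,\delta_0,z_{n-1})\nabla f(z_{n-1})$, $n\ge1$. Then either $\lim_{n\to\infty}\|z_n\|=\infty$ or $\inf_{n\ge0}\delta(f,\delta_0,z_n)>0$. 2) Conversely, let $\{\eta_n\}_{n\ge0}$ be a sequence of real numbers in $(0,\delta_0)$ such that $\inf_n\eta_n>0$. Define the sequence $\{z_n\}$ (starting at $z_0$) by the update rule $z_n=z_{n-1}-\eta_{n-1}\nabla f(z_{n-1})$ for $n\ge1$. Assume moreover that for every $n\ge1$ we have $f(z_n)-f(z_{n-1})\le-\alpha\eta_{n-1}\|\nabla f(z_{n-1})\|^2$. Then either $\lim_{n\to\infty}\|z_n\|=\infty$ or $\{z_n\}$ converges to a critical point of $f$.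
   Context: A critical point of $f$ is a point where $\nabla f$ vanishes. $\nabla f$ is locally Lipschitz near a critical point if it is (locally) Lipschitz on some open neighbourhood of that point. For $x\in\mathbb{R}^m$, $\delta(f,\delta_0,x)$ is the largest $\sigma$ in $\{\beta^n\delta_0: n=0,1,2,\ldots\}$ for which $f(x-\sigma\nabla f(x))-f(x)\le-\alpha\sigma\|\nabla f(x)\|^2$ (such a $\sigma$ always exists). *)

theory Defs
  imports "HOL-Analysis.Analysis"
begin

definition grad :: "('a::euclidean_space \<Rightarrow> real) \<Rightarrow> 'a \<Rightarrow> 'a" where
  "grad f x = (THE D. GDERIV f x :> D)"

text \<open>The value of \<^const>\<open>grad\<close> is meaningful only where \<open>f\<close> is differentiable, so
  differentiability is a separate conjunct here.\<close>

definition C1 :: "('a::euclidean_space \<Rightarrow> real) \<Rightarrow> bool" where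
  "C1 f \<longleftrightarrow> (\<forall>x. f differentiable (at x)) \<and> continuous_on UNIV (grad f)"

definition critical_point :: "('a::euclidean_space \<Rightarrow> real) \<Rightarrow> 'a \<Rightarrow> bool" where
  "critical_point f x \<longleftrightarrow> grad f x = 0"

definition lipschitz_near :: "('a::metric_space \<Rightarrow> 'b::metric_space) \<Rightarrow> 'a \<Rightarrow> bool" where
  "lipschitz_near g x \<longleftrightarrow> (\<exists>U L. open U \<and> x \<in> U \<and> L-lipschitz_on U g)"

definition armijo :: "real \<Rightarrow> ('a::euclidean_space \<Rightarrow> real) \<Rightarrow> 'a \<Rightarrow> real \<Rightarrow> bool" where
  "armijo \<alpha> f x \<sigma> \<longleftrightarrow>
     f (x - \<sigma> *\<^sub>R grad f x) - f x \<le> - \<alpha> * \<sigma> * (norm (grad f x))\<^sup>2"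

text \<open>The backtracking step size \<open>\<delta>(f, \<delta>\<^sub>0, x)\<close>, with its dependence on \<open>\<alpha>\<close> and \<open>\<beta>\<close> explicit.
  Lemma \<open>bt_step_greatest\<close> below shows that the maximum is attained.\<close>

definition bt_step :: "real \<Rightarrow> real \<Rightarrow> ('a::euclidean_space \<Rightarrow> real) \<Rightarrow> real \<Rightarrow> 'a \<Rightarrow> real" where
  "bt_step \<alpha> \<beta> f \<delta>0 x =
     (GREATEST \<sigma>. \<sigma> \<in> range (\<lambda>n::nat. \<beta> ^ n * \<delta>0) \<and> armijo \<alpha> f x \<sigma>)"

lemma grad_eq:
  assumes "GDERIV f x :> D"
  shows "grad f x = D"
  unfolding grad_def
proof (rule the_equality)
  fix E assume "GDERIV f x :> E"
  then have "(\<lambda>h. inner h E) = (\<lambda>h. inner h D)"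
    using assms unfolding gderiv_def by (rule has_derivative_unique)
  then show "E = D"
    by (metis inner_commute vector_eq_rdot)
qed (rule assms)

lemma GDERIV_grad:
  assumes "f differentiable (at x)"
  shows "GDERIV f x :> grad f x"
proof -
  obtain f' where f': "(f has_derivative f') (at x)"
    using assms unfolding differentiable_def by blast
  then interpret f': linear f' by (rule has_derivative_linear)
  have "f' h = inner h (\<Sum>b\<in>Basis. f' b *\<^sub>R b)" for h
  proof -
    have "f' h = f' (\<Sum>b\<in>Basis. inner h b *\<^sub>R b)"
      by (simp add: euclidean_representation)
    then show ?thesis
      by (simp add: f'.sum f'.scale inner_sum_right mult.commute)
  qed
  then have "f' = (\<lambda>h. inner h (\<Sum>b\<in>Basis. f' b *\<^sub>R b))" by (rule ext)
  with f' have "GDERIV f x :> (\<Sum>b\<in>Basis. f' b *\<^sub>R b)"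
    unfolding gderiv_def by simp
  then show ?thesis using grad_eq by metis
qed

lemma armijo_ex:
  assumes "f differentiable (at x)" "\<alpha> < 1" "0 < \<beta>" "\<beta> < 1" "0 < \<delta>0"
  shows "\<exists>n::nat. armijo \<alpha> f x (\<beta> ^ n * \<delta>0)"
proof (cases "grad f x = 0")
  case True
  then show ?thesis by (simp add: armijo_def)
next
  case False
  define g where "g = grad f x"
  have "(f has_derivative (\<lambda>h. inner h g)) (at (x - 0 *\<^sub>R g))"
    using GDERIV_grad[OF assms(1)] by (simp add: gderiv_def g_def)
  moreover have "((\<lambda>s. x - s *\<^sub>R g) has_derivative (\<lambda>s. - (s *\<^sub>R g))) (at (0::real))"
    by (auto intro!: derivative_eq_intros)
  ultimately have "((\<lambda>s. f (x - s *\<^sub>R g)) has_derivative (\<lambda>s. inner (- (s *\<^sub>R g)) g)) (at (0::real))"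
    using has_derivative_compose by blast
  moreover have "(\<lambda>s. inner (- (s *\<^sub>R g)) g) = (*) (- ((norm g)\<^sup>2))"
    by (auto simp: fun_eq_iff power2_norm_eq_inner)
  ultimately have "((\<lambda>s. f (x - s *\<^sub>R g)) has_real_derivative - ((norm g)\<^sup>2)) (at 0)"
    unfolding has_field_derivative_def by simp
  then have "((\<lambda>s. (f (x - s *\<^sub>R g) - f x) / s) \<longlongrightarrow> - ((norm g)\<^sup>2)) (at 0)"
    by (simp add: DERIV_def)
  moreover have "filterlim (\<lambda>n. \<beta> ^ n * \<delta>0) (at 0) sequentially"
    unfolding filterlim_at using assms
    by (auto intro!: tendsto_mult_left_zero LIMSEQ_realpow_zero)
  ultimately have "((\<lambda>n. (f (x - (\<beta> ^ n * \<delta>0) *\<^sub>R g) - f x) / (\<beta> ^ n * \<delta>0)) \<longlongrightarrow> - ((norm g)\<^sup>2)) sequentially"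
    by (rule filterlim_compose)
  moreover have "- ((norm g)\<^sup>2) < - \<alpha> * (norm g)\<^sup>2"
    using False assms by (simp add: g_def)
  ultimately have "\<forall>\<^sub>F n in sequentially.
      (f (x - (\<beta> ^ n * \<delta>0) *\<^sub>R g) - f x) / (\<beta> ^ n * \<delta>0) < - \<alpha> * (norm g)\<^sup>2"
    by (rule order_tendstoD)
  then obtain n where n: "(f (x - (\<beta> ^ n * \<delta>0) *\<^sub>R g) - f x) / (\<beta> ^ n * \<delta>0) < - \<alpha> * (norm g)\<^sup>2"
    using eventually_happens trivial_limit_sequentially by blast
  have "0 < \<beta> ^ n * \<delta>0" using assms by simp
  then have "f (x - (\<beta> ^ n * \<delta>0) *\<^sub>R g) - f x < - \<alpha> * (norm g)\<^sup>2 * (\<beta> ^ n * \<delta>0)"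
    using n by (simp only: pos_divide_less_eq)
  then have "armijo \<alpha> f x (\<beta> ^ n * \<delta>0)"
    by (simp add: armijo_def g_def mult.commute mult.left_commute)
  then show ?thesis by blast
qed

lemma bt_step_greatest:
  assumes "f differentiable (at x)" "\<alpha> < 1" "0 < \<beta>" "\<beta> < 1" "0 < \<delta>0"
  shows "bt_step \<alpha> \<beta> f \<delta>0 x \<in> range (\<lambda>n::nat. \<beta> ^ n * \<delta>0)"
    and "armijo \<alpha> f x (bt_step \<alpha> \<beta> f \<delta>0 x)"
    and "\<And>n::nat. armijo \<alpha> f x (\<beta> ^ n * \<delta>0) \<Longrightarrow> \<beta> ^ n * \<delta>0 \<le> bt_step \<alpha> \<beta> f \<delta>0 x"
proof -
  define N where "N = (LEAST n::nat. armijo \<alpha> f x (\<beta> ^ n * \<delta>0))"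
  have N: "armijo \<alpha> f x (\<beta> ^ N * \<delta>0)"
    unfolding N_def using armijo_ex[OF assms] by (rule LeastI_ex)
  have le: "\<beta> ^ n * \<delta>0 \<le> \<beta> ^ N * \<delta>0" if "armijo \<alpha> f x (\<beta> ^ n * \<delta>0)" for n
  proof -
    have "N \<le> n" unfolding N_def using that by (rule Least_le)
    then show ?thesis using assms by (simp add: power_decreasing)
  qed
  have "bt_step \<alpha> \<beta> f \<delta>0 x = \<beta> ^ N * \<delta>0"
    unfolding bt_step_def by (rule Greatest_equality) (use N le in auto)
  with N le show "bt_step \<alpha> \<beta> f \<delta>0 x \<in> range (\<lambda>n::nat. \<beta> ^ n * \<delta>0)"
    and "armijo \<alpha> f x (bt_step \<alpha> \<beta> f \<delta>0 x)"
    and "\<And>n::nat. armijo \<alpha> f x (\<beta> ^ n * \<delta>0) \<Longrightarrow> \<beta> ^ n * \<delta>0 \<le> bt_step \<alpha> \<beta> f \<delta>0 x"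
    by auto
qed

end

theory Submission
  imports Defs
begin

text \<open>An Armijo step moves by at most \<open>sqrt (\<eta> * \<delta>0) * norm (grad f)\<close>, so as soon as \<open>f\<close> stays
  bounded below along the sequence (in particular when there is a cluster point) the displacements
  tend to zero. If the sequence clustered at \<open>c\<close> without converging to it, its distance to \<open>c\<close> would
  cross every small radius infinitely often, and vanishing displacements would produce a cluster
  point on every small sphere around \<open>c\<close>, which is impossible when the cluster points are
  critical and hence countable in number. Cluster points are critical because step sizes stay away
  from zero near each of them; for backtracking this follows from the mean value theorem, using
  the Lipschitz condition at critical points and continuity of the gradient elsewhere.\<close>

section \<open>Cluster points and vanishing increments\<close>

definition subseq_limit :: "(nat \<Rightarrow> 'a::topological_space) \<Rightarrow> 'a \<Rightarrow> bool" where
  "subseq_limit z c \<longleftrightarrow> (\<exists>s. strict_mono s \<and> (z \<circ> s) \<longlonglongrightarrow> c)"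

text \<open>Bolzano-Weierstrass applied to the infinitely many indices satisfying both conditions.
  Carrying \<open>P\<close> along lets the extracted indices remember, for instance, that they are
  crossing times.\<close>

lemma subseq_limit_if_frequently_bounded:
  fixes z :: "nat \<Rightarrow> 'a::euclidean_space"
  assumes "\<exists>\<^sub>F n in sequentially. norm (z n) \<le> R \<and> P n"
  obtains s c where "strict_mono s" "(z \<circ> s) \<longlonglongrightarrow> c" "\<And>n. P (s n)"
proof -
  have "infinite {n. norm (z n) \<le> R \<and> P n}"
    using assms by (simp add: frequently_cofinite cofinite_eq_sequentially[symmetric])
  then obtain s :: "nat \<Rightarrow> nat" where s: "strict_mono s" "\<And>n. norm (z (s n)) \<le> R \<and> P (s n)"
    by (metis (no_types, lifting) infinite_enumerate mem_Collect_eq)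
  have "bounded (range (z \<circ> s))"
    using s by (auto simp: bounded_iff)
  then obtain c r where "strict_mono r" "((z \<circ> s) \<circ> r) \<longlonglongrightarrow> c"
    using bounded_imp_convergent_subsequence by blast
  with s show ?thesis
    by (intro that[of "s \<circ> r" c]) (auto simp: strict_mono_o o_assoc)
qed

lemma not_norm_at_top_imp_subseq_limit:
  fixes z :: "nat \<Rightarrow> 'a::euclidean_space"
  assumes "\<not> filterlim (\<lambda>n. norm (z n)) at_top sequentially"
  shows "\<exists>c. subseq_limit z c"
proof -
  obtain R where "\<exists>\<^sub>F n in sequentially. norm (z n) < R"
    using assms by (auto simp: filterlim_at_top frequently_def not_less)
  then have "\<exists>\<^sub>F n in sequentially. norm (z n) \<le> R \<and> True"
    by (rule frequently_elim1) simp
  then show ?thesis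
    unfolding subseq_limit_def by (rule subseq_limit_if_frequently_bounded) blast
qed

lemma nat_crossing:
  fixes P :: "nat \<Rightarrow> bool"
  assumes "P m" "\<not> P n" "m \<le> n"
  shows "\<exists>k\<ge>m. P k \<and> \<not> P (Suc k)"
  using assms(3,2,1) by (induction rule: dec_induct) auto

text \<open>The contradiction is one of cardinality: the distances from the cluster points to
  \<open>c\<close> form a countable set, yet without convergence they would fill an open
  interval.\<close>

lemma LIMSEQ_if_countable_subseq_limits:
  fixes z :: "nat \<Rightarrow> 'a::euclidean_space"
  assumes steps: "(\<lambda>n. z (Suc n) - z n) \<longlonglongrightarrow> 0"
    and count: "countable {x. subseq_limit z x}"
    and c: "subseq_limit z c"
  shows "z \<longlonglongrightarrow> c"
proof (rule ccontr)
  assume "\<not> z \<longlonglongrightarrow> c"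
  then obtain r0 where r0: "r0 > 0" "\<exists>\<^sub>F n in sequentially. r0 \<le> dist (z n) c"
    by (auto simp: tendsto_iff frequently_def not_le)
  obtain s where s: "strict_mono s" "(z \<circ> s) \<longlonglongrightarrow> c"
    using c by (auto simp: subseq_limit_def)
  have "r \<in> (\<lambda>x. dist x c) ` {x. subseq_limit z x}" if r: "0 < r" "r < r0" for r
  proof -
    define P where "P n \<longleftrightarrow> dist (z n) c \<le> r" for n
    \<comment> \<open>The sequence comes close to \<open>c\<close> infinitely often and also returns
      outside radius \<open>r0\<close> infinitely often, so it leaves the closed ball of radius
      \<open>r\<close> after every index. The norm bound at the exit times supplies
      compactness.\<close>
    have "\<exists>\<^sub>F n in sequentially. norm (z n) \<le> norm c + r \<and> (P n \<and> \<not> P (Suc n))"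
      unfolding frequently_sequentially
    proof
      fix N
      have "\<forall>\<^sub>F n in sequentially. dist ((z \<circ> s) n) c < r"
        using s(2) r(1) by (rule tendstoD)
      then have "\<forall>\<^sub>F n in sequentially. P (s n) \<and> N \<le> n"
        using eventually_ge_at_top[of N] by eventually_elim (auto simp: P_def)
      then obtain m where m: "P (s m)" "N \<le> m"
        using eventually_happens'[OF sequentially_bot] by blast
      obtain n where n: "s m \<le> n" "r0 \<le> dist (z n) c"
        using r0(2) unfolding frequently_sequentially by blast
      obtain k where k: "k \<ge> s m" "P k \<and> \<not> P (Suc k)"
        using nat_crossing[of P "s m" n] m n r by (auto simp: P_def)
      have "norm (z k) \<le> norm c + r"
        using k(2) norm_triangle_sub[of "z k" c] by (simp add: P_def dist_norm)
      moreover have "N \<le> k"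
        using k(1) m(2) seq_suble[OF s(1), of m] by linarith
      ultimately show "\<exists>n\<ge>N. norm (z n) \<le> norm c + r \<and> (P n \<and> \<not> P (Suc n))"
        using k(2) by blast
    qed
    then obtain t x where t: "strict_mono t" "(z \<circ> t) \<longlonglongrightarrow> x" "\<And>n. P (t n) \<and> \<not> P (Suc (t n))"
      by (rule subseq_limit_if_frequently_bounded) blast
    have lim: "(\<lambda>n. z (t n)) \<longlonglongrightarrow> x"
      using t(2) by (simp add: o_def)
    \<comment> \<open>The last point inside the ball and the first point outside share the limit
      \<open>x\<close>. The former gives \<open>dist x c \<le> r\<close>, the latter the reverse
      inequality.\<close>
    have "(\<lambda>n. z (Suc (t n)) - z (t n)) \<longlonglongrightarrow> 0"
      using LIMSEQ_subseq_LIMSEQ[OF steps t(1)] by (simp add: o_def)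
    from tendsto_add[OF this lim] have limS: "(\<lambda>n. z (Suc (t n))) \<longlonglongrightarrow> x"
      by simp
    have "dist x c \<le> r"
      by (rule LIMSEQ_le_const2[OF tendsto_dist[OF lim tendsto_const]])
        (use t(3) in \<open>auto simp: P_def\<close>)
    moreover have "r \<le> dist x c"
      by (rule LIMSEQ_le_const[OF tendsto_dist[OF limS tendsto_const]])
        (use t(3) in \<open>auto simp: P_def not_le intro: less_imp_le\<close>)
    ultimately show ?thesis
      using t(1,2) by (auto simp: subseq_limit_def)
  qed
  then have "{0<..<r0} \<subseteq> (\<lambda>x. dist x c) ` {x. subseq_limit z x}"
    by auto
  then have "countable {0<..<r0}"
    using count countable_subset by blast
  then show False
    using r0(1) uncountable_open_interval by blast
qed

section \<open>Armijo condition for uniformly small steps\<close>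

lemma C1_differentiable: "C1 f \<Longrightarrow> f differentiable (at x)"
  by (simp add: C1_def)

lemma C1_isCont_grad: "C1 f \<Longrightarrow> isCont (grad f) x"
  by (simp add: C1_def continuous_on_eq_continuous_at)

lemma C1_isCont: "C1 f \<Longrightarrow> isCont f x"
  by (simp add: C1_differentiable differentiable_imp_continuous_within)

lemma C1_line_mvt:
  assumes "C1 f" "0 < \<sigma>"
  obtains \<tau> where "0 < \<tau>" "\<tau> < \<sigma>" "f (y - \<sigma> *\<^sub>R v) - f y = - \<sigma> * inner (grad f (y - \<tau> *\<^sub>R v)) v"
proof -
  have deriv: "((\<lambda>\<tau>. f (y - \<tau> *\<^sub>R v)) has_real_derivative - inner (grad f (y - \<tau> *\<^sub>R v)) v) (at \<tau>)" for \<tau>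
  proof -
    have "(f has_derivative (\<lambda>h. inner h (grad f (y - \<tau> *\<^sub>R v)))) (at (y - \<tau> *\<^sub>R v))"
      using GDERIV_grad[OF C1_differentiable[OF assms(1)]] by (simp add: gderiv_def)
    moreover have "((\<lambda>\<tau>. y - \<tau> *\<^sub>R v) has_derivative (\<lambda>h. - (h *\<^sub>R v))) (at \<tau>)"
      by (auto intro!: derivative_eq_intros)
    ultimately have "((\<lambda>\<tau>. f (y - \<tau> *\<^sub>R v)) has_derivative
        (\<lambda>h. inner (- (h *\<^sub>R v)) (grad f (y - \<tau> *\<^sub>R v)))) (at \<tau>)"
      using has_derivative_compose by blast
    then show ?thesis
      unfolding has_field_derivative_def
      by (rule has_derivative_eq_rhs) (auto simp: fun_eq_iff inner_commute)
  qed
  obtain \<tau> where "0 < \<tau>" "\<tau> < \<sigma>"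
    "f (y - \<sigma> *\<^sub>R v) - f (y - 0 *\<^sub>R v) = (\<sigma> - 0) * - inner (grad f (y - \<tau> *\<^sub>R v)) v"
    using MVT2[OF assms(2) deriv] by blast
  then show ?thesis
    by (intro that) auto
qed

text \<open>By the mean value theorem the decrease of \<open>f\<close> over the step is
  \<open>\<sigma>\<close> times the inner product at some intermediate \<open>\<tau>\<close>, so a
  bound along the open segment suffices.\<close>

lemma armijo_if_inner_grad_ge:
  assumes "C1 f" "0 < \<sigma>"
    and "\<And>\<tau>. 0 < \<tau> \<Longrightarrow> \<tau> < \<sigma> \<Longrightarrow>
      \<alpha> * (norm (grad f y))\<^sup>2 \<le> inner (grad f (y - \<tau> *\<^sub>R grad f y)) (grad f y)"
  shows "armijo \<alpha> f y \<sigma>"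
proof -
  obtain \<tau> where \<tau>: "0 < \<tau>" "\<tau> < \<sigma>"
    "f (y - \<sigma> *\<^sub>R grad f y) - f y = - \<sigma> * inner (grad f (y - \<tau> *\<^sub>R grad f y)) (grad f y)"
    using C1_line_mvt[OF assms(1,2)] by metis
  have "\<sigma> * (\<alpha> * (norm (grad f y))\<^sup>2) \<le> \<sigma> * inner (grad f (y - \<tau> *\<^sub>R grad f y)) (grad f y)"
    using assms(3)[OF \<tau>(1,2)] assms(2) by (intro mult_left_mono) auto
  then show ?thesis
    by (simp add: armijo_def \<tau>(3) mult_ac)
qed

text \<open>Continuity bounds the gradient near \<open>x\<close>, so one \<open>d\<close> serves all
  nearby base points: half of the radius \<open>e\<close> is spent on the distance from
  \<open>y\<close> to \<open>x\<close>, half on the step.\<close>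

lemma small_step_in_nhds:
  assumes "C1 f" "open U" "x \<in> U"
  obtains d where "d > 0" "\<forall>\<^sub>F y in nhds x. \<forall>\<tau>. 0 \<le> \<tau> \<and> \<tau> \<le> d \<longrightarrow> y - \<tau> *\<^sub>R grad f y \<in> U"
proof -
  obtain e where e: "e > 0" "ball x e \<subseteq> U"
    using assms(2,3) open_contains_ball by blast
  \<comment> \<open>The summand 1 keeps \<open>M\<close> positive where the gradient vanishes and
    leaves room for the gradient to vary near \<open>x\<close>.\<close>
  define M where "M = norm (grad f x) + 1"
  have M: "M > 0" by (simp add: M_def add_nonneg_pos)
  have "((\<lambda>y. norm (grad f y)) \<longlongrightarrow> norm (grad f x)) (nhds x)"
    using C1_isCont_grad[OF assms(1), of x] by (intro tendsto_norm) (simp add: continuous_at tendsto_nhds_iff)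
  then have ev: "\<forall>\<^sub>F y in nhds x. norm (grad f y) < M"
    by (rule order_tendstoD) (simp add: M_def)
  have evb: "\<forall>\<^sub>F y in nhds x. dist y x < e / 2"
    using e by (auto simp: eventually_nhds_metric intro!: exI[of _ "e / 2"])
  have "\<forall>\<^sub>F y in nhds x. \<forall>\<tau>. 0 \<le> \<tau> \<and> \<tau> \<le> e / (2 * M) \<longrightarrow> y - \<tau> *\<^sub>R grad f y \<in> U"
    using ev evb
  proof eventually_elim
    case (elim y)
    show ?case
    proof (intro allI impI)
      fix \<tau> assume \<tau>: "0 \<le> \<tau> \<and> \<tau> \<le> e / (2 * M)"
      have "\<tau> * norm (grad f y) \<le> e / (2 * M) * M"
        using \<tau> elim M e by (intro mult_mono) auto
      also have "\<dots> = e / 2" using M by simp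
      finally have "dist (y - \<tau> *\<^sub>R grad f y) y \<le> e / 2"
        using \<tau> by (simp add: dist_norm)
      then have "dist (y - \<tau> *\<^sub>R grad f y) x < e"
        using elim(2) dist_triangle[of "y - \<tau> *\<^sub>R grad f y" x y] by linarith
      then show "y - \<tau> *\<^sub>R grad f y \<in> U"
        using e(2) by (auto simp: dist_commute)
    qed
  qed
  moreover have "e / (2 * M) > 0" using e M by simp
  ultimately show ?thesis by (rule that[rotated])
qed

lemma armijo_near_noncritical:
  assumes "C1 f" "\<alpha> < 1" "\<not> critical_point f x"
  obtains d where "d > 0" "\<forall>\<^sub>F y in nhds x. \<forall>\<sigma>. 0 < \<sigma> \<and> \<sigma> \<le> d \<longrightarrow> armijo \<alpha> f y \<sigma>"
proof -
  \<comment> \<open>\<open>G\<close> separates the displaced point from the base point. It is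
    positive at \<open>(x, x)\<close> because \<open>\<alpha> < 1\<close> and the gradient is
    nonzero there, so by continuity it stays positive on a product neighbourhood
    \<open>A \<times> B\<close>.\<close>
  define G where "G p = inner (grad f (fst p)) (grad f (snd p)) - \<alpha> * (norm (grad f (snd p)))\<^sup>2" for p
  have grad: "continuous_on UNIV (grad f)"
    using assms(1) by (simp add: C1_def)
  have "continuous_on UNIV G"
    unfolding G_def
    by (intro continuous_intros continuous_on_compose2[OF grad]) auto
  then have "open (G -` {0<..})"
    by (simp add: open_vimage)
  moreover have "(x, x) \<in> G -` {0<..}"
  proof -
    have "G (x, x) = (1 - \<alpha>) * (norm (grad f x))\<^sup>2"
      by (simp add: G_def power2_norm_eq_inner algebra_simps)
    then show ?thesis
      using assms(2,3) by (simp add: critical_point_def)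
  qed
  ultimately obtain A B where AB: "open A" "open B" "x \<in> A" "x \<in> B" "A \<times> B \<subseteq> G -` {0<..}"
    by (rule open_prod_elim) blast
  obtain d where d: "d > 0" "\<forall>\<^sub>F y in nhds x. \<forall>\<tau>. 0 \<le> \<tau> \<and> \<tau> \<le> d \<longrightarrow> y - \<tau> *\<^sub>R grad f y \<in> A"
    using small_step_in_nhds[OF assms(1) AB(1,3)] .
  have "\<forall>\<^sub>F y in nhds x. y \<in> B"
    using AB by (simp add: eventually_nhds_in_open)
  with d(2) have "\<forall>\<^sub>F y in nhds x. \<forall>\<sigma>. 0 < \<sigma> \<and> \<sigma> \<le> d \<longrightarrow> armijo \<alpha> f y \<sigma>"
  proof eventually_elim
    case (elim y)
    have "armijo \<alpha> f y \<sigma>" if "0 < \<sigma>" "\<sigma> \<le> d" for \<sigma>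
    proof (rule armijo_if_inner_grad_ge[OF assms(1) that(1)])
      fix \<tau> assume "0 < \<tau>" "\<tau> < \<sigma>"
      then have "(y - \<tau> *\<^sub>R grad f y, y) \<in> A \<times> B"
        using elim that by auto
      then have "G (y - \<tau> *\<^sub>R grad f y, y) > 0"
        using AB(5) by blast
      then show "\<alpha> * (norm (grad f y))\<^sup>2 \<le> inner (grad f (y - \<tau> *\<^sub>R grad f y)) (grad f y)"
        by (simp add: G_def)
    qed
    then show ?case by blast
  qed
  with d(1) show ?thesis by (rule that)
qed

text \<open>At a critical point the strict gap exploited by continuity closes. The Lipschitz bound
  replaces it, since the change of the gradient along a gradient step is itself proportional to the
  gradient norm at \<open>y\<close>.\<close>

lemma armijo_near_lipschitz:
  assumes "C1 f" "\<alpha> < 1" "lipschitz_near (grad f) x"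
  obtains d where "d > 0" "\<forall>\<^sub>F y in nhds x. \<forall>\<sigma>. 0 < \<sigma> \<and> \<sigma> \<le> d \<longrightarrow> armijo \<alpha> f y \<sigma>"
proof -
  obtain U L where U: "open U" "x \<in> U" "L-lipschitz_on U (grad f)"
    using assms(3) by (auto simp: lipschitz_near_def)
  have L: "L \<ge> 0" using U(3) by (rule lipschitz_on_nonneg)
  obtain d where d: "d > 0" "\<forall>\<^sub>F y in nhds x. \<forall>\<tau>. 0 \<le> \<tau> \<and> \<tau> \<le> d \<longrightarrow> y - \<tau> *\<^sub>R grad f y \<in> U"
    using small_step_in_nhds[OF assms(1) U(1,2)] .
  \<comment> \<open>The bound \<open>d\<close> keeps the segment in \<open>U\<close>; the second
    term ensures \<open>L * \<tau> \<le> 1 - \<alpha>\<close>, with \<open>L + 1\<close> avoiding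
    division by zero when \<open>L = 0\<close>.\<close>
  define e where "e = min d ((1 - \<alpha>) / (L + 1))"
  have e: "e > 0" "e \<le> d" using d assms(2) L by (auto simp: e_def)
  have "\<forall>\<^sub>F y in nhds x. y \<in> U"
    using U by (simp add: eventually_nhds_in_open)
  with d(2) have "\<forall>\<^sub>F y in nhds x. \<forall>\<sigma>. 0 < \<sigma> \<and> \<sigma> \<le> e \<longrightarrow> armijo \<alpha> f y \<sigma>"
  proof eventually_elim
    case (elim y)
    have "armijo \<alpha> f y \<sigma>" if \<sigma>: "0 < \<sigma>" "\<sigma> \<le> e" for \<sigma>
    proof (rule armijo_if_inner_grad_ge[OF assms(1) \<sigma>(1)])
      fix \<tau> assume \<tau>: "0 < \<tau>" "\<tau> < \<sigma>"
      let ?g = "grad f y" and ?h = "grad f (y - \<tau> *\<^sub>R grad f y)"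
      have "dist ?h ?g \<le> L * dist (y - \<tau> *\<^sub>R ?g) y"
        using elim \<tau> \<sigma> e by (intro lipschitz_onD[OF U(3)]) auto
      then have dist: "norm (?h - ?g) \<le> L * \<tau> * norm ?g"
        using \<tau> by (simp add: dist_norm mult.assoc)
      have "\<tau> \<le> (1 - \<alpha>) / (L + 1)"
        using \<tau> \<sigma> by (simp add: e_def)
      then have "\<tau> * (L + 1) \<le> 1 - \<alpha>"
        using L by (simp add: pos_le_divide_eq)
      then have "L * \<tau> \<le> 1 - \<alpha>"
        using \<tau> by (simp add: algebra_simps)
      \<comment> \<open>Of the full amount \<open>(norm ?g)\<^sup>2\<close>, the variation of the
        gradient costs at most the fraction \<open>1 - \<alpha>\<close>, leaving the fraction
        \<open>\<alpha>\<close>.\<close>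
      have "- inner (?h - ?g) ?g \<le> norm (?h - ?g) * norm ?g"
        using norm_cauchy_schwarz[of "?g - ?h" ?g] by (simp add: norm_minus_commute inner_diff_left)
      also have "\<dots> \<le> (L * \<tau> * norm ?g) * norm ?g"
        by (intro mult_right_mono dist) simp
      also have "\<dots> = (L * \<tau>) * (norm ?g)\<^sup>2"
        by (simp add: power2_eq_square)
      also have "\<dots> \<le> (1 - \<alpha>) * (norm ?g)\<^sup>2"
        using \<open>L * \<tau> \<le> 1 - \<alpha>\<close> by (intro mult_right_mono) auto
      finally show "\<alpha> * (norm ?g)\<^sup>2 \<le> inner ?h ?g"
        by (simp add: inner_diff_left power2_norm_eq_inner algebra_simps)
    qed
    then show ?case by blast
  qed
  with e(1) show ?thesis by (rule that)
qed

section \<open>Local lower bounds for backtracking steps\<close>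

lemma bt_step_pos:
  assumes "C1 f" "\<alpha> < 1" "0 < \<beta>" "\<beta> < 1" "0 < \<delta>0"
  shows "0 < bt_step \<alpha> \<beta> f \<delta>0 x"
  using bt_step_greatest(1)[OF C1_differentiable[OF assms(1), of x] assms(2-)] assms by auto

lemma bt_step_le:
  assumes "C1 f" "\<alpha> < 1" "0 < \<beta>" "\<beta> < 1" "0 < \<delta>0"
  shows "bt_step \<alpha> \<beta> f \<delta>0 x \<le> \<delta>0"
  using bt_step_greatest(1)[OF C1_differentiable[OF assms(1), of x] assms(2-)] assms
  by (auto simp: power_le_one mult_left_le_one_le)

text \<open>A single grid value \<open>\<beta> ^ N * \<delta>0\<close> below the local threshold
  \<open>e\<close> passes the Armijo test at every nearby \<open>y\<close>. Since the backtracking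
  step is the largest passing grid value, it cannot be smaller.\<close>

lemma bt_step_locally_bounded_below:
  assumes f: "C1 f" and param: "\<alpha> < 1" "0 < \<beta>" "\<beta> < 1" "0 < \<delta>0"
    and lip: "critical_point f x \<longrightarrow> lipschitz_near (grad f) x"
  obtains d where "d > 0" "\<forall>\<^sub>F y in nhds x. d \<le> bt_step \<alpha> \<beta> f \<delta>0 y"
proof -
  obtain e where e: "e > 0" "\<forall>\<^sub>F y in nhds x. \<forall>\<sigma>. 0 < \<sigma> \<and> \<sigma> \<le> e \<longrightarrow> armijo \<alpha> f y \<sigma>"
    using lip armijo_near_noncritical[OF f param(1)] armijo_near_lipschitz[OF f param(1)] by metis
  obtain N where "\<beta> ^ N < e / \<delta>0"
    using real_arch_pow_inv[of "e / \<delta>0" \<beta>] e param by auto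
  then have N: "0 < \<beta> ^ N * \<delta>0" "\<beta> ^ N * \<delta>0 \<le> e"
    using param by (auto simp: pos_less_divide_eq)
  from e(2) have "\<forall>\<^sub>F y in nhds x. \<beta> ^ N * \<delta>0 \<le> bt_step \<alpha> \<beta> f \<delta>0 y"
    by eventually_elim
      (use N in \<open>blast intro: bt_step_greatest(3)[OF C1_differentiable[OF f] param]\<close>)
  with N(1) show ?thesis by (rule that)
qed

section \<open>Convergence of Armijo descent\<close>

text \<open>Common core of both claims. Stating \<open>lower\<close> along convergent subsequences
  covers the local bound for backtracking as well as a global positive infimum, and the bound
  \<open>\<eta> n \<le> \<delta>0\<close> is non-strict because backtracking may accept
  \<open>\<delta>0\<close> itself.\<close>

lemma descent_converges:
  fixes f :: "'a::euclidean_space \<Rightarrow> real"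
  assumes f: "C1 f" and count: "countable {x. critical_point f x}" and \<alpha>: "0 < \<alpha>"
    and \<eta>: "\<And>n. 0 < \<eta> n" "\<And>n. \<eta> n \<le> \<delta>0"
    and step: "\<And>n. z (Suc n) = z n - \<eta> n *\<^sub>R grad f (z n)"
    and armijo: "\<And>n. armijo \<alpha> f (z n) (\<eta> n)"
    and lower: "\<And>s c. strict_mono s \<Longrightarrow> (z \<circ> s) \<longlonglongrightarrow> c \<Longrightarrow>
      \<exists>d>0. \<forall>\<^sub>F n in sequentially. d \<le> \<eta> (s n)"
    and not_top: "\<not> filterlim (\<lambda>n. norm (z n)) at_top sequentially"
  shows "\<exists>c. critical_point f c \<and> z \<longlonglongrightarrow> c"
proof -
  obtain c where c: "subseq_limit z c"
    using not_norm_at_top_imp_subseq_limit[OF not_top] by blast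
  then obtain s where s: "strict_mono s" "(z \<circ> s) \<longlonglongrightarrow> c"
    by (auto simp: subseq_limit_def)
  \<comment> \<open>\<open>h n\<close> is the guaranteed decrease without the factor
    \<open>\<alpha>\<close>. Its decay controls the displacements and, where \<open>\<eta>\<close>
    is bounded below, the gradients.\<close>
  define h where "h n = \<eta> n * (norm (grad f (z n)))\<^sup>2" for n
  have h0: "0 \<le> h n" for n
    using \<eta>(1)[of n] by (simp add: h_def)
  have desc: "\<alpha> * h n \<le> f (z n) - f (z (Suc n))" for n
    using armijo[of n] by (simp add: armijo_def step h_def mult.assoc)
  have dec: "decseq (\<lambda>n. f (z n))"
    using desc h0 \<alpha> by (intro decseq_SucI) (smt (verit) mult_nonneg_nonneg)
  have lims: "(\<lambda>n. f (z (s n))) \<longlonglongrightarrow> f c"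
    using isCont_tendsto_compose[OF C1_isCont[OF f] s(2)] by (simp add: o_def)
  \<comment> \<open>Values along a subsequence tend to \<open>f c\<close>, and the whole sequence of
    values is decreasing, so \<open>f c\<close> bounds all of them from below.\<close>
  have "f c \<le> f (z n)" for n
  proof (rule LIMSEQ_le_const2[OF lims], intro exI allI impI)
    fix k assume "n \<le> k"
    then have "n \<le> s k" using seq_suble[OF s(1), of k] by linarith
    then show "f (z (s k)) \<le> f (z n)" using dec by (simp add: decseq_def)
  qed
  then obtain l where l: "(\<lambda>n. f (z n)) \<longlonglongrightarrow> l"
    using decseq_convergent[OF dec] by blast
  have "(\<lambda>n. f (z n) - f (z (Suc n))) \<longlonglongrightarrow> l - l"
    by (intro tendsto_diff l LIMSEQ_Suc[OF l])
  then have "(\<lambda>n. (f (z n) - f (z (Suc n))) / \<alpha>) \<longlonglongrightarrow> 0"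
    using tendsto_divide[OF _ tendsto_const, of _ 0 _ \<alpha>] \<alpha> by fastforce
  then have h: "h \<longlonglongrightarrow> 0"
    by (rule tendsto_sandwich[OF _ _ tendsto_const, rotated 2])
      (use h0 desc \<alpha> in \<open>auto simp: pos_le_divide_eq mult.commute\<close>)

  \<comment> \<open>The squared displacement equals \<open>\<eta> n * h n\<close>, which is where
    the upper bound \<open>\<delta>0\<close> on the step sizes enters.\<close>
  have "(\<lambda>n. sqrt (\<delta>0 * h n)) \<longlonglongrightarrow> sqrt (\<delta>0 * 0)"
    by (intro tendsto_intros h)
  then have "(\<lambda>n. z (Suc n) - z n) \<longlonglongrightarrow> 0"
  proof (rule Lim_null_comparison[rotated, OF tendsto_eq_rhs])
    have "norm (z (Suc n) - z n) \<le> sqrt (\<delta>0 * h n)" for n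
    proof (rule real_le_rsqrt)
      have "(norm (z (Suc n) - z n))\<^sup>2 = \<eta> n * h n"
        by (simp add: step h_def power_mult_distrib power2_eq_square mult_ac)
      also have "\<dots> \<le> \<delta>0 * h n"
        by (intro mult_right_mono \<eta> h0)
      finally show "(norm (z (Suc n) - z n))\<^sup>2 \<le> \<delta>0 * h n" .
    qed
    then show "\<forall>\<^sub>F n in sequentially. norm (z (Suc n) - z n) \<le> sqrt (\<delta>0 * h n)"
      by simp
  qed simp
  moreover have crit: "critical_point f x" if x: "subseq_limit z x" for x
  proof -
    obtain t where t: "strict_mono t" "(z \<circ> t) \<longlonglongrightarrow> x"
      using x by (auto simp: subseq_limit_def)
    obtain d where d: "d > 0" "\<forall>\<^sub>F n in sequentially. d \<le> \<eta> (t n)"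
      using lower[OF t] by blast
    have gx: "(\<lambda>n. grad f (z (t n))) \<longlonglongrightarrow> grad f x"
      using isCont_tendsto_compose[OF C1_isCont_grad[OF f] t(2)] by (simp add: o_def)
    \<comment> \<open>Along \<open>t\<close> the quantity \<open>h\<close> tends to zero while
      eventually dominating \<open>d\<close> times the squared gradient norm.\<close>
    have "d * (norm (grad f x))\<^sup>2 \<le> 0"
    proof (rule tendsto_le[OF sequentially_bot])
      show "(\<lambda>n. h (t n)) \<longlonglongrightarrow> 0"
        using LIMSEQ_subseq_LIMSEQ[OF h t(1)] by (simp add: o_def)
      show "(\<lambda>n. d * (norm (grad f (z (t n))))\<^sup>2) \<longlonglongrightarrow> d * (norm (grad f x))\<^sup>2"
        by (intro tendsto_intros gx)
      show "\<forall>\<^sub>F n in sequentially. d * (norm (grad f (z (t n))))\<^sup>2 \<le> h (t n)"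
        using d(2) by eventually_elim (simp add: h_def mult_right_mono)
    qed
    then show ?thesis
      using d(1) by (simp add: critical_point_def mult_le_0_iff)
  qed
  moreover have "countable {x. subseq_limit z x}"
    using count by (rule countable_subset[rotated]) (use crit in blast)
  ultimately show ?thesis
    using LIMSEQ_if_countable_subseq_limits c by blast
qed

section \<open>Positive infima and the two claims\<close>

lemma INF_pos_if_eventually_ge:
  fixes u :: "nat \<Rightarrow> real"
  assumes "\<And>n. 0 < u n" "0 < d" "\<forall>\<^sub>F n in sequentially. d \<le> u n"
  shows "0 < (INF n. u n)"
proof -
  obtain N where N: "\<And>n. n \<ge> N \<Longrightarrow> d \<le> u n"
    using assms(3) by (auto simp: eventually_sequentially)
  \<comment> \<open>Inserting \<open>d\<close> covers the tail and keeps the set nonempty when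
    \<open>N = 0\<close>; the finitely many earlier terms have a positive minimum.\<close>
  define m where "m = Min (insert d (u ` {..<N}))"
  have "m > 0"
    using assms(1,2) by (simp add: m_def)
  moreover have "m \<le> u n" for n
  proof (cases "n < N")
    case False
    have "m \<le> d" by (simp add: m_def)
    also have "d \<le> u n" using N False by simp
    finally show ?thesis .
  qed (simp add: m_def)
  then have "m \<le> (INF n. u n)"
    by (intro cINF_greatest) auto
  ultimately show ?thesis by linarith
qed

theorem theorem2p5:
  fixes f :: "real ^ 'm \<Rightarrow> real" and z0 :: "real ^ 'm" and \<alpha> \<beta> \<delta>0 :: real
  assumes "C1 f"
    and "countable {x. critical_point f x}"
    and "0 < \<alpha>" "\<alpha> < 1" "0 < \<beta>" "\<beta> < 1" "0 < \<delta>0"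
  shows
    "((\<forall>x. critical_point f x \<longrightarrow> lipschitz_near (grad f) x) \<longrightarrow>
      (\<forall>z :: nat \<Rightarrow> real ^ 'm.
        z 0 = z0 \<and>
        (\<forall>n\<ge>1. z n = z (n - 1) - bt_step \<alpha> \<beta> f \<delta>0 (z (n - 1)) *\<^sub>R grad f (z (n - 1))) \<longrightarrow>
        filterlim (\<lambda>n. norm (z n)) at_top sequentially \<or>
        (INF n. bt_step \<alpha> \<beta> f \<delta>0 (z n)) > 0))
     \<and>
     (\<forall>(\<eta> :: nat \<Rightarrow> real) (z :: nat \<Rightarrow> real ^ 'm).
        (\<forall>n. 0 < \<eta> n \<and> \<eta> n < \<delta>0) \<and>
        (INF n. \<eta> n) > 0 \<and>
        z 0 = z0 \<and>
        (\<forall>n\<ge>1. z n = z (n - 1) - \<eta> (n - 1) *\<^sub>R grad f (z (n - 1))) \<and>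
        (\<forall>n\<ge>1. f (z n) - f (z (n - 1)) \<le> - \<alpha> * \<eta> (n - 1) * (norm (grad f (z (n - 1))))\<^sup>2) \<longrightarrow>
        filterlim (\<lambda>n. norm (z n)) at_top sequentially \<or>
        (\<exists>c. critical_point f c \<and> z \<longlonglongrightarrow> c))"
proof (intro conjI impI allI; elim conjE)
  fix z :: "nat \<Rightarrow> real ^ 'm"
  let ?\<delta> = "bt_step \<alpha> \<beta> f \<delta>0"
  assume lip: "\<forall>x. critical_point f x \<longrightarrow> lipschitz_near (grad f) x"
    and z: "\<forall>n\<ge>1. z n = z (n - 1) - ?\<delta> (z (n - 1)) *\<^sub>R grad f (z (n - 1))"
  note param = \<open>\<alpha> < 1\<close> \<open>0 < \<beta>\<close> \<open>\<beta> < 1\<close> \<open>0 < \<delta>0\<close>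
  \<comment> \<open>Used twice: along subsequences to prove convergence of \<open>z\<close>, then
    along \<open>z\<close> itself to bound its steps.\<close>
  have lower: "\<exists>d>0. \<forall>\<^sub>F n in sequentially. d \<le> ?\<delta> (w n)" if "w \<longlonglongrightarrow> c" for w c
  proof -
    obtain d where "d > 0" "\<forall>\<^sub>F y in nhds c. d \<le> ?\<delta> y"
      using bt_step_locally_bounded_below[OF \<open>C1 f\<close> param] lip by metis
    then show ?thesis
      using eventually_compose_filterlim[OF _ that] by blast
  qed
  have "(INF n. ?\<delta> (z n)) > 0" if top: "\<not> filterlim (\<lambda>n. norm (z n)) at_top sequentially"
  proof -
    \<comment> \<open>Convergence comes first: once \<open>z\<close> has a limit, the local bound at
      that single point controls all late steps.\<close>
    have "\<exists>c. critical_point f c \<and> z \<longlonglongrightarrow> c"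
    proof (rule descent_converges[OF assms(1-3) _ _ _ _ _ top])
      show "z (Suc n) = z n - ?\<delta> (z n) *\<^sub>R grad f (z n)" for n
        using z[rule_format, of "Suc n"] by simp
      show "armijo \<alpha> f (z n) (?\<delta> (z n))" for n
        using bt_step_greatest(2)[OF C1_differentiable[OF \<open>C1 f\<close>] param] .
      show "\<exists>d>0. \<forall>\<^sub>F n in sequentially. d \<le> ?\<delta> (z (s n))" if "(z \<circ> s) \<longlonglongrightarrow> c" for s c
        using lower[OF that] by simp
    qed (use bt_step_pos[OF \<open>C1 f\<close> param] bt_step_le[OF \<open>C1 f\<close> param] in auto)
    then obtain d where "d > 0" "\<forall>\<^sub>F n in sequentially. d \<le> ?\<delta> (z n)"
      using lower by blast
    then show ?thesis
      by (intro INF_pos_if_eventually_ge bt_step_pos[OF \<open>C1 f\<close> param])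
  qed
  then show "filterlim (\<lambda>n. norm (z n)) at_top sequentially \<or> (INF n. ?\<delta> (z n)) > 0"
    by blast
next
  fix \<eta> :: "nat \<Rightarrow> real" and z :: "nat \<Rightarrow> real ^ 'm"
  assume \<eta>: "\<forall>n. 0 < \<eta> n \<and> \<eta> n < \<delta>0" and inf: "(INF n. \<eta> n) > 0"
    and z: "\<forall>n\<ge>1. z n = z (n - 1) - \<eta> (n - 1) *\<^sub>R grad f (z (n - 1))"
    and desc: "\<forall>n\<ge>1. f (z n) - f (z (n - 1)) \<le> - \<alpha> * \<eta> (n - 1) * (norm (grad f (z (n - 1))))\<^sup>2"
  have step: "z (Suc n) = z n - \<eta> n *\<^sub>R grad f (z n)" for n
    using z[rule_format, of "Suc n"] by simp
  have armijo: "armijo \<alpha> f (z n) (\<eta> n)" for n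
    using desc[rule_format, of "Suc n"] by (simp add: armijo_def step)
  \<comment> \<open>On the reals \<open>INF\<close> is known to be a lower bound only for sets
    bounded below, which positivity of \<open>\<eta>\<close> provides.\<close>
  have "bdd_below (range \<eta>)"
    using \<eta> by (intro bdd_belowI2[of _ 0]) (auto intro: less_imp_le)
  then have "(INF n. \<eta> n) \<le> \<eta> n" for n
    by (rule cINF_lower) simp
  then have "\<exists>d>0. \<forall>\<^sub>F n in sequentially. d \<le> \<eta> (s n)" for s :: "nat \<Rightarrow> nat"
    using inf by (intro exI[of _ "INF n. \<eta> n"]) auto
  then have "\<exists>c. critical_point f c \<and> z \<longlonglongrightarrow> c"
    if "\<not> filterlim (\<lambda>n. norm (z n)) at_top sequentially"
    using \<eta> by (intro descent_converges[OF assms(1-3) _ _ step armijo _ that])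
      (auto intro: less_imp_le)
  then show "filterlim (\<lambda>n. norm (z n)) at_top sequentially \<or> (\<exists>c. critical_point f c \<and> z \<longlonglongrightarrow> c)"
    by blast
qed

end
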